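(* There is no $\mathbf{PLK}$-proof of any sequent of one of the following forms: (1) $\Lambda\Rightarrow\Lambda$; (2) $p_1,\ldots,p_k\Rightarrow\Lambda$; (3) $\Lambda\Rightarrow q_1,\ldots,q_l$; (4) $p_1,\ldots,p_k\Rightarrow q_1,\ldots,q_l$; where the $p_i$'s and $q_j$'s are propositional variables and, for (4), $\{p_1,\ldots,p_k\}\cap\{q_1,\ldots,q_l\}=\emptyset$.
   Context: Formulas are built from a countably infinite set of propositional variables using the unary connective $\neg$ and the binary connectives $\land,\lor,\to$. A sequent is an expression $\Gamma\Rightarrow\Delta$ where $\Gamma,\Delta$ are finite ordered lists (possibly empty) of formulas. $\Lambda$ denotes the empty list. Commas denote concatenation of lists. The sequent system $\mathbf{PLK}$ has the following rules (premise(s) / conclusion), for all formulas $A,B$ and all lists $\Gamma,\Delta,\Pi,\Sigma$. Axioms: $p\Rightarrow p$ for $p$ a propositional variable. Weakening: WL: $\Gamma\Rightarrow\Delta$ / $A,\Gamma\Rightarrow\Delta$. WR: $\Gamma\Rightarrow\Delta$ / $\Gamma\Rightarrow\Delta,A$. Contraction: CL: $A,A,\Gamma\Rightarrow\Delta$ / $A,\Gamma\Rightarrow\Delta$. CR: $\Gamma\Rightarrow\Delta,A,A$ / $\Gamma\Rightarrow\Delta,A$. Exchange: EL: $\Gamma,A,B,\Pi\Rightarrow\Delta$ / $\Gamma,B,A,\Pi\Rightarrow\Delta$. ER: $\Gamma\Rightarrow\Delta,A,B,\Sigma$ / $\Gamma\Rightarrow\Delta,B,A,\Sigma$. Logical rules: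 $\neg$L: $\Gamma\Rightarrow\Delta,A$ / $\neg A,\Gamma\Rightarrow\Delta$. $\neg$R: $A,\Gamma\Rightarrow\Delta$ / $\Gamma\Rightarrow\Delta,\neg A$. $\land$L: $A,\Gamma\Rightarrow\Delta$ / $A\land B,\Gamma\Rightarrow\Delta$, and also $B,\Gamma\Rightarrow\Delta$ / $A\land B,\Gamma\Rightarrow\Delta$. $\land$R: $\Gamma\Rightarrow\Delta,A$ and $\Gamma\Rightarrow\Delta,B$ / $\Gamma\Rightarrow\Delta,A\land B$. $\lor$L: $A,\Gamma\Rightarrow\Delta$ and $B,\Gamma\Rightarrow\Delta$ / $A\lor B,\Gamma\Rightarrow\Delta$. $\lor$R: $\Gamma\Rightarrow\Delta,A$ / $\Gamma\Rightarrow\Delta,A\lor B$, and also $\Gamma\Rightarrow\Delta,B$ / $\Gamma\Rightarrow\Delta,A\lor B$. $\to$L: $\Gamma\Rightarrow\Delta,A$ and $B,\Gamma\Rightarrow\Delta$ / $A\to B,\Gamma\Rightarrow\Delta$. $\to$R: $A,\Gamma\Rightarrow\Delta,B$ / $\Gamma\Rightarrow\Delta,A\to B$. Cut: $\Gamma\Rightarrow\Delta,A$ and $A,\Gamma\Rightarrow\Delta$ / $\Gamma\Rightarrow\Delta$. A $\mathbf{PLK}$-proof of a sequent is a finite tree of sequents with axioms as leaves and the given sequent as root, in which every non-leaf node is the conclusion of an instance of a rule whose premises are its children. *)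

theory Defs
  imports Main
begin

datatype form =
    Var nat
  | Neg form (\<open>\<^bold>\<not> _\<close> [70] 70)
  | Conj form form (infixr \<open>\<^bold>\<and>\<close> 68)
  | Disj form form (infixr \<open>\<^bold>\<or>\<close> 67)
  | Imp form form (infixr \<open>\<^bold>\<rightarrow>\<close> 66)

datatype sequent = Sequent "form list" "form list" (infix \<open>\<Rightarrow>\<^sub>s\<close> 55)

inductive plk_axiom :: "sequent \<Rightarrow> bool" where
  Ax: "plk_axiom ([Var p] \<Rightarrow>\<^sub>s [Var p])"

text \<open>The instances of the rules: the list of premises, in order, and the conclusion.\<close>

inductive plk_rule :: "sequent list \<Rightarrow> sequent \<Rightarrow> bool" where
  WL: "plk_rule [\<Gamma> \<Rightarrow>\<^sub>s \<Delta>] (A # \<Gamma> \<Rightarrow>\<^sub>s \<Delta>)"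
| WR: "plk_rule [\<Gamma> \<Rightarrow>\<^sub>s \<Delta>] (\<Gamma> \<Rightarrow>\<^sub>s \<Delta> @ [A])"
| CL: "plk_rule [A # A # \<Gamma> \<Rightarrow>\<^sub>s \<Delta>] (A # \<Gamma> \<Rightarrow>\<^sub>s \<Delta>)"
| CR: "plk_rule [\<Gamma> \<Rightarrow>\<^sub>s \<Delta> @ [A, A]] (\<Gamma> \<Rightarrow>\<^sub>s \<Delta> @ [A])"
| EL: "plk_rule [\<Gamma> @ [A, B] @ \<Pi> \<Rightarrow>\<^sub>s \<Delta>] (\<Gamma> @ [B, A] @ \<Pi> \<Rightarrow>\<^sub>s \<Delta>)"
| ER: "plk_rule [\<Gamma> \<Rightarrow>\<^sub>s \<Delta> @ [A, B] @ \<Sigma>] (\<Gamma> \<Rightarrow>\<^sub>s \<Delta> @ [B, A] @ \<Sigma>)"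
| NegL: "plk_rule [\<Gamma> \<Rightarrow>\<^sub>s \<Delta> @ [A]] ((\<^bold>\<not> A) # \<Gamma> \<Rightarrow>\<^sub>s \<Delta>)"
| NegR: "plk_rule [A # \<Gamma> \<Rightarrow>\<^sub>s \<Delta>] (\<Gamma> \<Rightarrow>\<^sub>s \<Delta> @ [\<^bold>\<not> A])"
| ConjL1: "plk_rule [A # \<Gamma> \<Rightarrow>\<^sub>s \<Delta>] ((A \<^bold>\<and> B) # \<Gamma> \<Rightarrow>\<^sub>s \<Delta>)"
| ConjL2: "plk_rule [B # \<Gamma> \<Rightarrow>\<^sub>s \<Delta>] ((A \<^bold>\<and> B) # \<Gamma> \<Rightarrow>\<^sub>s \<Delta>)"
| ConjR: "plk_rule [\<Gamma> \<Rightarrow>\<^sub>s \<Delta> @ [A], \<Gamma> \<Rightarrow>\<^sub>s \<Delta> @ [B]] (\<Gamma> \<Rightarrow>\<^sub>s \<Delta> @ [A \<^bold>\<and> B])"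
| DisjL: "plk_rule [A # \<Gamma> \<Rightarrow>\<^sub>s \<Delta>, B # \<Gamma> \<Rightarrow>\<^sub>s \<Delta>] ((A \<^bold>\<or> B) # \<Gamma> \<Rightarrow>\<^sub>s \<Delta>)"
| DisjR1: "plk_rule [\<Gamma> \<Rightarrow>\<^sub>s \<Delta> @ [A]] (\<Gamma> \<Rightarrow>\<^sub>s \<Delta> @ [A \<^bold>\<or> B])"
| DisjR2: "plk_rule [\<Gamma> \<Rightarrow>\<^sub>s \<Delta> @ [B]] (\<Gamma> \<Rightarrow>\<^sub>s \<Delta> @ [A \<^bold>\<or> B])"
| ImpL: "plk_rule [\<Gamma> \<Rightarrow>\<^sub>s \<Delta> @ [A], B # \<Gamma> \<Rightarrow>\<^sub>s \<Delta>] ((A \<^bold>\<rightarrow> B) # \<Gamma> \<Rightarrow>\<^sub>s \<Delta>)"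
| ImpR: "plk_rule [A # \<Gamma> \<Rightarrow>\<^sub>s \<Delta> @ [B]] (\<Gamma> \<Rightarrow>\<^sub>s \<Delta> @ [A \<^bold>\<rightarrow> B])"
| Cut: "plk_rule [\<Gamma> \<Rightarrow>\<^sub>s \<Delta> @ [A], A # \<Gamma> \<Rightarrow>\<^sub>s \<Delta>] (\<Gamma> \<Rightarrow>\<^sub>s \<Delta>)"

datatype seq_tree = Node (root: sequent) (children: "seq_tree list")

fun plk_tree :: "seq_tree \<Rightarrow> bool" where
  "plk_tree (Node S ts) \<longleftrightarrow>
     (if ts = [] then plk_axiom S
      else plk_rule (map root ts) S \<and> (\<forall>t\<in>set ts. plk_tree t))"

definition plk_proof_of :: "seq_tree \<Rightarrow> sequent \<Rightarrow> bool" where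
  "plk_proof_of t S \<longleftrightarrow> plk_tree t \<and> root t = S"

end

theory Submission
  imports Defs
begin

text \<open>
  The reason is the soundness of the calculus for two-valued semantics. Read a sequent as the claim
  that every valuation making all formulas on the left true makes some formula on the right true.
  Axioms are valid in this sense and every rule, the cut rule included, preserves truth under each
  fixed valuation, so every provable sequent is valid (\<open>plk_sound\<close>). A sequent of variables whose two
  sides are disjoint is refuted by the valuation making exactly the variables on the left true
  (\<open>disjoint_atomic_not_valid\<close>). The first three forms are the instances of the fourth in which one
  side or both sides are empty, where disjointness is trivial.
\<close>

fun holds :: "(nat \<Rightarrow> bool) \<Rightarrow> form \<Rightarrow> bool" where
  "holds v (Var p) \<longleftrightarrow> v p"
| "holds v (\<^bold>\<not> A) \<longleftrightarrow> \<not> holds v A"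
| "holds v (A \<^bold>\<and> B) \<longleftrightarrow> holds v A \<and> holds v B"
| "holds v (A \<^bold>\<or> B) \<longleftrightarrow> holds v A \<or> holds v B"
| "holds v (A \<^bold>\<rightarrow> B) \<longleftrightarrow> (holds v A \<longrightarrow> holds v B)"

fun seq_holds :: "(nat \<Rightarrow> bool) \<Rightarrow> sequent \<Rightarrow> bool" where
  "seq_holds v (\<Gamma> \<Rightarrow>\<^sub>s \<Delta>) \<longleftrightarrow>
     ((\<forall>A\<in>set \<Gamma>. holds v A) \<longrightarrow> (\<exists>B\<in>set \<Delta>. holds v B))"

lemma plk_axiom_holds: "plk_axiom S \<Longrightarrow> seq_holds v S"
  by (auto elim: plk_axiom.cases)

text \<open>
  Preservation is for each valuation separately, not only of validity. Structural rules preserve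
  truth because it depends only on the sets of formulas on the two sides and survives enlarging
  them; logical rules follow the truth tables. For cut, the valuation decides the cut formula: if it is true, it can be dropped from the
  left of the second premise; if it is false, from the right of the first.
\<close>

lemma plk_rule_preserves_holds:
  assumes "plk_rule Ss S" and "\<forall>S'\<in>set Ss. seq_holds v S'"
  shows "seq_holds v S"
  using assms by (cases rule: plk_rule.cases) auto

lemma plk_tree_root_holds: "plk_tree t \<Longrightarrow> seq_holds v (root t)"
proof (induction t)
  case (Node S ts)
  show ?case
  proof (cases "ts = []")
    case True
    then show ?thesis
      using Node.prems plk_axiom_holds by simp
  next
    case False
    then have "plk_rule (map root ts) S" and "\<forall>t\<in>set ts. plk_tree t"
      using Node.prems by simp_all
    then show ?thesis
      using Node.IH plk_rule_preserves_holds by simp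
  qed
qed

theorem plk_sound: "plk_proof_of t S \<Longrightarrow> seq_holds v S"
  using plk_tree_root_holds unfolding plk_proof_of_def by blast

lemma disjoint_atomic_not_valid:
  assumes "set ps \<inter> set qs = {}"
  shows "\<not> seq_holds (\<lambda>p. p \<in> set ps) (map Var ps \<Rightarrow>\<^sub>s map Var qs)"
  using assms by auto

lemma disjoint_atomic_unprovable:
  "set ps \<inter> set qs = {} \<Longrightarrow> \<nexists>t. plk_proof_of t (map Var ps \<Rightarrow>\<^sub>s map Var qs)"
  using plk_sound disjoint_atomic_not_valid by blast

theorem theorem2p12:
  shows "(\<nexists>t. plk_proof_of t ([] \<Rightarrow>\<^sub>s [])) \<and>
    (\<forall>ps :: nat list. \<nexists>t. plk_proof_of t (map Var ps \<Rightarrow>\<^sub>s [])) \<and>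
    (\<forall>qs :: nat list. \<nexists>t. plk_proof_of t ([] \<Rightarrow>\<^sub>s map Var qs)) \<and>
    (\<forall>(ps :: nat list) (qs :: nat list). set ps \<inter> set qs = {} \<longrightarrow>
       (\<nexists>t. plk_proof_of t (map Var ps \<Rightarrow>\<^sub>s map Var qs)))"
  using disjoint_atomic_unprovable[of "[]" "[]"]
    disjoint_atomic_unprovable[of _ "[]"] disjoint_atomic_unprovable[of "[]"]
    disjoint_atomic_unprovable
  by simp

end
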